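(* Let $\mathcal A$ be a $C^*$-algebra and $\mathcal X$ a Hilbert $\mathcal A$-module. Suppose there exists a non-adjointable bounded $\mathcal A$-linear mapping $f:\mathcal X\to\mathcal X$. Then there exist positive constants $c_\alpha$ and respective ``compact'' $\mathcal A$-linear operators $K_\alpha:\mathcal X\to\mathcal X$ ($\alpha\in I$), with at least countably infinitely many pairs $(c_\alpha,K_\alpha)$, such that for each $\alpha\in I$ the mapping $f$ is $\varphi$-perturbed for the function $\varphi(x,y)=c_\alpha\cdot\|x\|\cdot\|y\|$ and for $g=K_\alpha^*$, i.e. $$\|\langle f(x),y\rangle-\langle x,K_\alpha^*(y)\rangle\|\le c_\alpha\,\|x\|\,\|y\|\qquad(x,y\in\mathcal X).$$
   Context: A (right) Hilbert $\mathcal A$-module is a complex linear space $\mathcal X$ that is a right $\mathcal A$-module with $\lambda(xa)=x(\lambda a)=(\lambda x)a$ for $x\in\mathcal X$, $a\in\mathcal A$, $\lambda\in\mathbb C$, equipped with an $\mathcal A$-valued inner product $\langle\cdot,\cdot\rangle:\mathcal X\times\mathcal X\to\mathcal A$ satisfying: (i) $\langle x,x\rangle\ge0$, with $\langle x,x\rangle=0$ iff $x=0$; (ii) $\langle x,y+\lambda z\rangle=\langle x,y\rangle+\lambda\langle x,z\rangle$; (iii) $\langle x,ya\rangle=\langle x,y\rangle a$; (iv) $\langle x,y\rangle^*=\langle y,x\rangle$; and complete for the norm $\|x\|=\|\langle x,x\rangle\|^{1/2}$. An everywhere defined mapping $f:\mathcal X\to\mathcal X$ is called adjointable if there is a mapping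 $g:\mathcal X\to\mathcal X$ with $\langle f(x),y\rangle=\langle x,g(y)\rangle$ for all $x,y\in\mathcal X$; this (unique) $g$ is the adjoint of $f$, denoted $f^*$. A bounded $\mathcal A$-linear operator $K:\mathcal X\to\mathcal X$ is called ``compact'' if it belongs to the operator-norm-closed linear span of the elementary operators $\theta_{x,y}$ ($x,y\in\mathcal X$), $\theta_{x,y}(z)=x\langle y,z\rangle$. ``Compact'' operators are adjointable. *)

theory Defs
  imports "HOL-Analysis.Analysis"
begin

class complex_vector = real_vector +
  fixes scaleC :: "complex \<Rightarrow> 'a \<Rightarrow> 'a"  (infixr \<open>*\<^sub>C\<close> 75)
  assumes scaleC_add_right: "c *\<^sub>C (x + y) = c *\<^sub>C x + c *\<^sub>C y"
    and scaleC_add_left: "(c + d) *\<^sub>C x = c *\<^sub>C x + d *\<^sub>C x"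
    and scaleC_scaleC: "c *\<^sub>C d *\<^sub>C x = (c * d) *\<^sub>C x"
    and scaleC_one: "1 *\<^sub>C x = x"
    and scaleR_eq_scaleC: "r *\<^sub>R x = complex_of_real r *\<^sub>C x"

text \<open>Complex C*-algebras; no unit is assumed, and the zero algebra is not excluded.\<close>

class cstar_algebra = complex_vector + real_normed_algebra + banach +
  fixes star :: "'a \<Rightarrow> 'a"
  assumes norm_scaleC: "norm (c *\<^sub>C a) = cmod c * norm a"
    and mult_scaleC_left: "(c *\<^sub>C a) * b = c *\<^sub>C (a * b)"
    and mult_scaleC_right: "a * (c *\<^sub>C b) = c *\<^sub>C (a * b)"
    and star_star: "star (star a) = a"
    and star_add: "star (a + b) = star a + star b"
    and star_scaleC: "star (c *\<^sub>C a) = cnj c *\<^sub>C star a"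
    and star_mult: "star (a * b) = star b * star a"
    and cstar_identity: "norm (star a * a) = (norm a)\<^sup>2"

definition positive :: "'a::cstar_algebra \<Rightarrow> bool"
  where "positive a \<longleftrightarrow> (\<exists>b. a = star b * b)"

text \<open>
  Right Hilbert modules; \<open>act x a\<close> is \<open>x a\<close>, and \<open>ip\<close> is linear in its second argument.
  The class \<^class>\<open>banach\<close> together with \<open>norm_eq\<close> expresses completeness for the norm
  induced by the inner product.
\<close>

locale hilbert_module =
  fixes act :: "'x::{complex_vector, banach} \<Rightarrow> 'a::cstar_algebra \<Rightarrow> 'x"
    and ip :: "'x \<Rightarrow> 'x \<Rightarrow> 'a"
  assumes act_add_left: "act (x + y) a = act x a + act y a"
    and act_add_right: "act x (a + b) = act x a + act x b"
    and act_mult: "act x (a * b) = act (act x a) b"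
    and act_scaleC_right: "c *\<^sub>C act x a = act x (c *\<^sub>C a)"
    and act_scaleC_left: "act x (c *\<^sub>C a) = act (c *\<^sub>C x) a"
    and ip_positive: "positive (ip x x)"
    and ip_eq_zero_iff: "ip x x = 0 \<longleftrightarrow> x = 0"
    and ip_linear_right: "ip x (y + c *\<^sub>C z) = ip x y + c *\<^sub>C ip x z"
    and ip_act_right: "ip x (act y a) = ip x y * a"
    and ip_star: "star (ip x y) = ip y x"
    and norm_eq: "norm x = sqrt (norm (ip x x))"

definition bounded_module_map ::
    "('x::{complex_vector, banach} \<Rightarrow> 'a::cstar_algebra \<Rightarrow> 'x) \<Rightarrow> ('x \<Rightarrow> 'x) \<Rightarrow> bool"
  where "bounded_module_map act f \<longleftrightarrow>
    bounded_linear f \<and> (\<forall>c x. f (c *\<^sub>C x) = c *\<^sub>C f x) \<and> (\<forall>x a. f (act x a) = act (f x) a)"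

definition is_adjoint :: "('x \<Rightarrow> 'x \<Rightarrow> 'a) \<Rightarrow> ('x \<Rightarrow> 'x) \<Rightarrow> ('x \<Rightarrow> 'x) \<Rightarrow> bool"
  where "is_adjoint ip f g \<longleftrightarrow> (\<forall>x y. ip (f x) y = ip x (g y))"

definition adjointable :: "('x \<Rightarrow> 'x \<Rightarrow> 'a) \<Rightarrow> ('x \<Rightarrow> 'x) \<Rightarrow> bool"
  where "adjointable ip f \<longleftrightarrow> (\<exists>g. is_adjoint ip f g)"

text \<open>Meaningful only for adjointable maps on a Hilbert module, where the adjoint is unique.\<close>

definition adjoint_map :: "('x \<Rightarrow> 'x \<Rightarrow> 'a) \<Rightarrow> ('x \<Rightarrow> 'x) \<Rightarrow> 'x \<Rightarrow> 'x"
  where "adjoint_map ip f = (THE g. is_adjoint ip f g)"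

definition elementary_op ::
    "('x \<Rightarrow> 'a \<Rightarrow> 'x) \<Rightarrow> ('x \<Rightarrow> 'x \<Rightarrow> 'a) \<Rightarrow> 'x \<Rightarrow> 'x \<Rightarrow> 'x \<Rightarrow> 'x"
  where "elementary_op act ip x y z = act x (ip y z)"

definition elementary_span ::
    "('x::{complex_vector, banach} \<Rightarrow> 'a::cstar_algebra \<Rightarrow> 'x) \<Rightarrow> ('x \<Rightarrow> 'x \<Rightarrow> 'a) \<Rightarrow> ('x \<Rightarrow> 'x) set"
  where "elementary_span act ip =
    {F. \<exists>(n::nat) c x y. F = (\<lambda>z. \<Sum>i<n. c i *\<^sub>C elementary_op act ip (x i) (y i) z)}"

definition compact_operator ::
    "('x::{complex_vector, banach} \<Rightarrow> 'a::cstar_algebra \<Rightarrow> 'x) \<Rightarrow> ('x \<Rightarrow> 'x \<Rightarrow> 'a) \<Rightarrow> ('x \<Rightarrow> 'x) \<Rightarrow> bool"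
  where "compact_operator act ip K \<longleftrightarrow> bounded_module_map act K \<and>
    (\<forall>\<epsilon>>0. \<exists>F\<in>elementary_span act ip. onorm (\<lambda>z. K z - F z) < \<epsilon>)"

definition perturbed ::
    "('x \<Rightarrow> 'x \<Rightarrow> 'a::cstar_algebra) \<Rightarrow> ('x \<Rightarrow> 'x \<Rightarrow> real) \<Rightarrow> ('x \<Rightarrow> 'x) \<Rightarrow> ('x \<Rightarrow> 'x) \<Rightarrow> bool"
  where "perturbed ip \<phi> f g \<longleftrightarrow> (\<forall>x y. norm (ip (f x) y - ip x (g y)) \<le> \<phi> x y)"

end

theory Submission imports Defs begin

text \<open>
  Polarization bounds the \<open>'a\<close>-valued inner product by
  \<open>norm (ip x y) \<le> 4 * norm x * norm y\<close>. The constant 4 is not sharp, but this bound avoids the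
  order structure of the C*-algebra on which the sharp Cauchy--Schwarz inequality rests. It
  follows that a bounded map \<open>f\<close> is perturbed with respect to the adjoint of \<^emph>\<open>every\<close> bounded
  adjointable operator \<open>K\<close>: since \<open>ip (f x) y - ip x (K* y) = ip (f x - K x) y\<close>, any constant
  above four times the operator norm of \<open>f - K\<close> will do.

  It remains to find infinitely many ``compact'' operators whose adjoints exist. The real
  multiples of one elementary operator \<open>z \<mapsto> w \<langle>w, z\<rangle>\<close> are self-adjoint, and they are pairwise
  different as soon as \<open>w \<noteq> 0\<close>, because \<open>w \<langle>w, w\<rangle> \<noteq> 0\<close> by the C*-identity. Non-adjointability of
  \<open>f\<close> supplies such a \<open>w\<close>: the zero map is adjointable, so \<open>f\<close> is not zero. The operators \<open>K\<close>
  obtained in this way are themselves pairwise different, not just the pairs \<open>(c, K)\<close>.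
\<close>

section \<open>Complex scalars and the involution\<close>

lemma scaleC_zero_left [simp]: "0 *\<^sub>C (x::'a::complex_vector) = 0"
  using scaleR_eq_scaleC[of 0 x] by simp

lemma scaleC_zero_right [simp]: "c *\<^sub>C (0::'a::complex_vector) = 0"
  using scaleC_add_right[of c 0 "0::'a"] by simp

lemma scaleC_minus_left: "(- c) *\<^sub>C (x::'a::complex_vector) = - (c *\<^sub>C x)"
  using scaleC_add_left[of c "- c" x] by (simp add: eq_neg_iff_add_eq_0 add.commute)

lemma scaleC_minus_right: "c *\<^sub>C (- x::'a::complex_vector) = - (c *\<^sub>C x)"
  using scaleC_add_right[of c x "- x"] by (simp add: eq_neg_iff_add_eq_0 add.commute)

lemma scaleC_diff_right: "c *\<^sub>C (x - y::'a::complex_vector) = c *\<^sub>C x - c *\<^sub>C y"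
  using scaleC_add_right[of c x "- y"] by (simp add: scaleC_minus_right)

lemma scaleC_commute: "c *\<^sub>C (d *\<^sub>C (x::'a::complex_vector)) = d *\<^sub>C (c *\<^sub>C x)"
  by (simp add: scaleC_scaleC mult.commute)

lemma star_zero [simp]: "star (0::'a::cstar_algebra) = 0"
  using star_add[of 0 "0::'a"] by simp

text \<open>The C*-identity gives \<open>\<parallel>a\<parallel>\<^sup>2 \<le> \<parallel>a*\<parallel> \<parallel>a\<parallel>\<close>, and then the same with \<open>a*\<close> in place of \<open>a\<close>.\<close>

lemma norm_star: "norm (star a) = norm (a::'a::cstar_algebra)"
proof -
  have le: "norm b \<le> norm (star b)" for b :: 'a
  proof (cases "b = 0")
    case False
    have "norm b * norm b \<le> norm (star b) * norm b"
      using norm_mult_ineq[of "star b" b] by (simp add: cstar_identity power2_eq_square)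
    with False show ?thesis by simp
  qed simp
  show ?thesis
    using le[of a] le[of "star a"] by (simp add: star_star)
qed

section \<open>A Cauchy--Schwarz inequality from polarization\<close>

context hilbert_module
begin

lemma ip_zero_right [simp]: "ip x 0 = 0"
  using ip_linear_right[of x 0 1 0] by (simp add: scaleC_one)

lemma ip_scaleC_right: "ip x (c *\<^sub>C y) = c *\<^sub>C ip x y"
  using ip_linear_right[of x 0 c y] by simp

lemma ip_add_right: "ip x (y + z) = ip x y + ip x z"
  using ip_linear_right[of x y 1 z] by (simp add: scaleC_one)

lemma ip_diff_right: "ip x (y - z) = ip x y - ip x z"
  using ip_add_right[of x "y - z" z] by simp

lemma ip_zero_left [simp]: "ip 0 x = 0"
  using ip_star[of x 0] by simp

lemma ip_add_left: "ip (x + y) z = ip x z + ip y z"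
  by (metis ip_add_right ip_star star_add)

lemma ip_diff_left: "ip (x - y) z = ip x z - ip y z"
  using ip_add_left[of "x - y" y z] by simp

lemma ip_scaleC_left: "ip (c *\<^sub>C x) y = cnj c *\<^sub>C ip x y"
  by (metis ip_scaleC_right ip_star star_scaleC)

lemma ip_scaleR_right: "ip x (r *\<^sub>R y) = r *\<^sub>R ip x y"
  by (simp add: scaleR_eq_scaleC ip_scaleC_right)

lemma ip_scaleR_left: "ip (r *\<^sub>R x) y = r *\<^sub>R ip x y"
  by (simp add: scaleR_eq_scaleC ip_scaleC_left)

lemma norm_ip_self: "norm (ip x x) = (norm x)\<^sup>2"
  by (simp add: norm_eq)

lemma norm_scaleC_module: "norm (c *\<^sub>C x) = cmod c * norm x" for x :: 'x
  by (simp add: norm_eq[of "c *\<^sub>C x"] norm_eq[of x] ip_scaleC_left ip_scaleC_right norm_scaleC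
      real_sqrt_mult)

text \<open>
  Twice the left-hand side inside the norm is \<open>\<langle>x + y, x + y\<rangle> - \<langle>x - y, x - y\<rangle>\<close>, and the norms of
  both terms are squares of norms of vectors.
\<close>

lemma norm_ip_symmetrized_le: "norm (ip x y + ip y x) \<le> (norm x + norm y)\<^sup>2"
proof -
  have "ip (x + y) (x + y) - ip (x - y) (x - y) = 2 *\<^sub>R (ip x y + ip y x)"
    by (simp add: ip_add_left ip_add_right ip_diff_left ip_diff_right scaleR_2)
  then have "2 * norm (ip x y + ip y x) = norm (ip (x + y) (x + y) - ip (x - y) (x - y))"
    by simp
  also have "\<dots> \<le> (norm (x + y))\<^sup>2 + (norm (x - y))\<^sup>2"
    using norm_triangle_ineq4[of "ip (x + y) (x + y)" "ip (x - y) (x - y)"]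
    by (simp add: norm_ip_self)
  also have "\<dots> \<le> (norm x + norm y)\<^sup>2 + (norm x + norm y)\<^sup>2"
    by (intro add_mono power_mono norm_triangle_ineq norm_triangle_ineq4) auto
  finally show ?thesis by simp
qed

text \<open>
  The inner product is the mean of its symmetrized part and its antisymmetrized part; replacing
  \<open>y\<close> by \<open>\<i> y\<close> exchanges these two up to a factor of modulus one.
\<close>

lemma norm_ip_le_square: "norm (ip x y) \<le> (norm x + norm y)\<^sup>2"
proof -
  have "ip x (\<i> *\<^sub>C y) + ip (\<i> *\<^sub>C y) x = \<i> *\<^sub>C (ip x y - ip y x)"
    by (simp add: ip_scaleC_left ip_scaleC_right scaleC_minus_left scaleC_diff_right)
  then have "norm (ip x y - ip y x) = norm (ip x (\<i> *\<^sub>C y) + ip (\<i> *\<^sub>C y) x)"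
    by (simp add: norm_scaleC)
  also have "\<dots> \<le> (norm x + norm y)\<^sup>2"
    using norm_ip_symmetrized_le[of x "\<i> *\<^sub>C y"] by (simp add: norm_scaleC_module)
  finally have "norm (ip x y - ip y x) \<le> (norm x + norm y)\<^sup>2" .
  moreover have "2 *\<^sub>R ip x y = (ip x y + ip y x) + (ip x y - ip y x)"
    by (simp add: scaleR_2)
  then have "2 * norm (ip x y) \<le> norm (ip x y + ip y x) + norm (ip x y - ip y x)"
    by (metis norm_triangle_ineq norm_scaleR abs_numeral)
  ultimately show ?thesis
    using norm_ip_symmetrized_le[of x y] by linarith
qed

text \<open>Normalizing both vectors turns the quadratic bound into a bilinear one.\<close>

lemma norm_ip_le: "norm (ip x y) \<le> 4 * norm x * norm y"
proof (cases "x = 0 \<or> y = 0")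
  case False
  have "norm (ip (x /\<^sub>R norm x) (y /\<^sub>R norm y)) \<le> 4"
    using norm_ip_le_square[of "x /\<^sub>R norm x" "y /\<^sub>R norm y"] False by simp
  with False show ?thesis
    by (simp add: ip_scaleR_left ip_scaleR_right field_simps)
qed auto

section \<open>Perturbation by adjointable operators\<close>

lemma is_adjoint_unique:
  assumes "is_adjoint ip f g" "is_adjoint ip f h"
  shows "g = h"
proof
  fix y
  have "ip x (g y - h y) = 0" for x
    using assms by (simp add: is_adjoint_def ip_diff_right)
  then show "g y = h y"
    by (metis ip_eq_zero_iff right_minus_eq)
qed

lemma adjoint_map_eq: "is_adjoint ip f g \<Longrightarrow> adjoint_map ip f = g"
  unfolding adjoint_map_def by (blast intro: the_equality is_adjoint_unique)

lemma perturbed_adjoint: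
  assumes f: "bounded_linear f" and K: "bounded_linear K" and adj: "is_adjoint ip K g"
    and c: "4 * onorm (\<lambda>x. f x - K x) \<le> c"
  shows "perturbed ip (\<lambda>x y. c * norm x * norm y) f g"
  unfolding perturbed_def
proof (intro allI)
  fix x y :: 'x
  have "norm (f x - K x) \<le> onorm (\<lambda>x. f x - K x) * norm x"
    by (intro onorm bounded_linear_sub f K)
  then have "4 * norm (f x - K x) \<le> c * norm x"
    using mult_right_mono[OF c norm_ge_zero[of x]] by linarith
  then have "4 * norm (f x - K x) * norm y \<le> c * norm x * norm y"
    by (rule mult_right_mono) simp
  moreover have "ip (f x) y - ip x (g y) = ip (f x - K x) y"
    using adj by (simp add: is_adjoint_def ip_diff_left)
  ultimately show "norm (ip (f x) y - ip x (g y)) \<le> c * norm x * norm y"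
    using norm_ip_le[of "f x - K x" y] by simp
qed

section \<open>Elementary operators\<close>

lemma norm_act_le: "norm (act x a) \<le> norm x * norm a"
proof -
  have "ip (act x a) (act x a) = star a * (ip x x * a)"
    by (metis ip_act_right ip_star star_mult mult.assoc)
  then have "(norm (act x a))\<^sup>2 = norm (star a * (ip x x * a))"
    by (metis norm_ip_self)
  also have "\<dots> \<le> norm (star a) * (norm (ip x x) * norm a)"
    by (meson norm_mult_ineq mult_left_mono norm_ge_zero order_trans)
  also have "norm (star a) = norm a"
    by (rule norm_star)
  finally have "(norm (act x a))\<^sup>2 \<le> (norm x * norm a)\<^sup>2"
    by (simp add: norm_ip_self power2_eq_square algebra_simps)
  then show ?thesis
    by (rule power2_le_imp_le) simp
qed

lemma act_scaleR: "act x (r *\<^sub>R a) = r *\<^sub>R act x a"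
  by (simp add: scaleR_eq_scaleC act_scaleC_right)

lemma act_scaleR_left: "act (r *\<^sub>R x) a = r *\<^sub>R act x a"
  by (simp add: scaleR_eq_scaleC act_scaleC_right act_scaleC_left)

lemma elementary_op_scaleC:
  "elementary_op act ip x y (c *\<^sub>C z) = c *\<^sub>C elementary_op act ip x y z"
  by (simp add: elementary_op_def ip_scaleC_right act_scaleC_right)

lemma bounded_linear_elementary_op: "bounded_linear (elementary_op act ip x y)"
proof (rule bounded_linear_intro)
  show "elementary_op act ip x y (u + v)
      = elementary_op act ip x y u + elementary_op act ip x y v" for u v
    by (simp add: elementary_op_def ip_add_right act_add_right)
  show "elementary_op act ip x y (r *\<^sub>R u) = r *\<^sub>R elementary_op act ip x y u" for r u
    by (simp add: elementary_op_def ip_scaleR_right act_scaleR)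
  show "norm (elementary_op act ip x y u) \<le> norm u * (norm x * (4 * norm y))" for u
    using order_trans[OF norm_act_le[of x "ip y u"] mult_left_mono[OF norm_ip_le[of y u]]]
    by (simp add: elementary_op_def algebra_simps)
qed

lemma compact_operator_scaleR_elementary_op:
  "compact_operator act ip (\<lambda>z. r *\<^sub>R elementary_op act ip x y z)"
proof -
  let ?K = "\<lambda>z. r *\<^sub>R elementary_op act ip x y z"
  have "bounded_linear ?K"
    by (intro bounded_linear_const_scaleR bounded_linear_elementary_op)
  moreover have "?K (c *\<^sub>C z) = c *\<^sub>C ?K z" for c z
    by (simp add: elementary_op_scaleC scaleR_eq_scaleC scaleC_commute)
  moreover have "?K (act z a) = act (?K z) a" for z a
    by (simp add: elementary_op_def ip_act_right act_mult act_scaleR_left)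
  ultimately have "bounded_module_map act ?K"
    by (simp add: bounded_module_map_def)
  moreover have "?K \<in> elementary_span act ip"
    unfolding elementary_span_def
    by (rule CollectI, rule exI[of _ 1], rule exI[of _ "\<lambda>_. complex_of_real r"],
        rule exI[of _ "\<lambda>_. x"], rule exI[of _ "\<lambda>_. y"]) (simp add: scaleR_eq_scaleC)
  ultimately show ?thesis
    unfolding compact_operator_def
    by (auto intro!: bexI[of _ ?K] simp: onorm_zero)
qed

lemma is_adjoint_scaleR_elementary_op:
  "is_adjoint ip (\<lambda>z. r *\<^sub>R elementary_op act ip x y z) (\<lambda>z. r *\<^sub>R elementary_op act ip y x z)"
proof -
  have "ip (act x (ip y u)) v = ip u (act y (ip x v))" for u v
    by (metis ip_act_right ip_star star_mult)
  then show ?thesis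
    by (simp add: is_adjoint_def elementary_op_def ip_scaleR_left ip_scaleR_right)
qed

text \<open>
  Since \<open>\<langle>w, w\<rangle>\<close> is self-adjoint, the C*-identity says that \<open>\<langle>w, w \<langle>w, w\<rangle>\<rangle> = \<langle>w, w\<rangle>\<^sup>2\<close> vanishes only
  together with \<open>\<langle>w, w\<rangle>\<close>.
\<close>

lemma elementary_op_self_nonzero:
  assumes "w \<noteq> 0"
  shows "elementary_op act ip w w w \<noteq> 0"
proof
  assume "elementary_op act ip w w w = 0"
  then have "ip w (act w (ip w w)) = 0"
    by (simp add: elementary_op_def)
  then have "star (ip w w) * ip w w = 0"
    by (simp add: ip_act_right ip_star)
  then have "ip w w = 0"
    using cstar_identity[of "ip w w"] by simp
  with assms show False
    by (simp add: ip_eq_zero_iff)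
qed

end

theorem proposition2p8:
  fixes act :: "'x::{complex_vector, banach} \<Rightarrow> 'a::cstar_algebra \<Rightarrow> 'x"
    and ip :: "'x \<Rightarrow> 'x \<Rightarrow> 'a"
    and f :: "'x \<Rightarrow> 'x"
  assumes "hilbert_module act ip"
    and "bounded_module_map act f"
    and "\<not> adjointable ip f"
  shows "\<exists>P :: (real \<times> ('x \<Rightarrow> 'x)) set. infinite P \<and>
    (\<forall>(c, K) \<in> P. c > 0 \<and> compact_operator act ip K \<and>
      perturbed ip (\<lambda>x y. c * norm x * norm y) f (adjoint_map ip K))"
proof -
  interpret hilbert_module act ip by fact
  have f: "bounded_linear f"
    using assms(2) by (simp add: bounded_module_map_def)
  obtain w where w: "f w \<noteq> 0"
  proof -
    have "is_adjoint ip f (\<lambda>_. 0)" if "\<And>w. f w = 0"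
      by (simp add: is_adjoint_def that)
    with assms(3) show thesis
      using that by (auto simp: adjointable_def)
  qed
  then have "w \<noteq> 0"
    using bounded_linear.linear[OF f] linear_0 by blast
  define K where "K r z = r *\<^sub>R elementary_op act ip w w z" for r z
  \<comment> \<open>The summand 1 makes the constant positive without knowing that \<open>f \<noteq> K r\<close>.\<close>
  define c where "c r = 4 * onorm (\<lambda>x. f x - K r x) + 1" for r
  have K: "bounded_linear (K r)" for r
    unfolding K_def by (intro bounded_linear_const_scaleR bounded_linear_elementary_op)
  have adj: "is_adjoint ip (K r) (K r)" for r
    unfolding K_def by (rule is_adjoint_scaleR_elementary_op)
  have "c r > 0" for r
    using onorm_pos_le[OF bounded_linear_sub[OF f K[of r]]] by (simp add: c_def)
  moreover have "compact_operator act ip (K r)" for r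
    unfolding K_def by (rule compact_operator_scaleR_elementary_op)
  moreover have "perturbed ip (\<lambda>x y. c r * norm x * norm y) f (adjoint_map ip (K r))" for r
    unfolding adjoint_map_eq[OF adj] by (rule perturbed_adjoint[OF f K adj]) (simp add: c_def)
  moreover have "inj (\<lambda>r. (c r, K r))"
  proof (rule injI)
    fix r s
    assume "(c r, K r) = (c s, K s)"
    then have "K r w = K s w" by simp
    with elementary_op_self_nonzero[OF \<open>w \<noteq> 0\<close>] show "r = s"
      by (simp add: K_def)
  qed
  then have "infinite (range (\<lambda>r. (c r, K r)))"
    by (simp add: finite_image_iff infinite_UNIV_char_0)
  ultimately show ?thesis
    by (intro exI[of _ "range (\<lambda>r. (c r, K r))"]) auto
qed

end
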